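(* Let $A, B$ be alphabets, let $S$ be a finite semigroup, and let $\varphi : A^{+} \to S$, $\psi : B^{+} \to S$ be epimorphisms. Then the fiber product $\Pi(\varphi,\psi) = \{(u,v) \in A^{+}\times B^{+} : \varphi(u) = \psi(v)\}$ is not finitely generated (as a semigroup).
   Context: Semigroups are non-empty. For an alphabet (set) $A$, $A^{+}$ is the free semigroup of non-empty finite words over $A$ under concatenation. "Epimorphism" means surjective homomorphism. $\Pi(\varphi,\psi)$ is a subsemigroup of the direct product $A^{+}\times B^{+}$ with componentwise multiplication. *)

theory Defs
  imports "HOL-Algebra.Group"
begin

text \<open>
  Semigroups are represented by the record type of HOL-Algebra, so that its
  constants \<^const>\<open>hom\<close>, \<^const>\<open>epi\<close> and \<^const>\<open>DirProd\<close> apply. Only the carrier and the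
  multiplication matter; none of the definitions below constrains the field
  \<^const>\<open>one\<close>.
\<close>

definition is_semigroup :: "('a, 'm) monoid_scheme \<Rightarrow> bool" where
  "is_semigroup G \<longleftrightarrow>
     carrier G \<noteq> {} \<and>
     (\<forall>x\<in>carrier G. \<forall>y\<in>carrier G. x \<otimes>\<^bsub>G\<^esub> y \<in> carrier G) \<and>
     (\<forall>x\<in>carrier G. \<forall>y\<in>carrier G. \<forall>z\<in>carrier G.
        (x \<otimes>\<^bsub>G\<^esub> y) \<otimes>\<^bsub>G\<^esub> z = x \<otimes>\<^bsub>G\<^esub> (y \<otimes>\<^bsub>G\<^esub> z))"

inductive_set semigroup_span :: "('a, 'm) monoid_scheme \<Rightarrow> 'a set \<Rightarrow> 'a set"
  for G and X where
  incl: "x \<in> X \<Longrightarrow> x \<in> semigroup_span G X"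
| mult: "x \<in> semigroup_span G X \<Longrightarrow> y \<in> semigroup_span G X \<Longrightarrow>
    x \<otimes>\<^bsub>G\<^esub> y \<in> semigroup_span G X"

definition finitely_generated_semigroup :: "('a, 'm) monoid_scheme \<Rightarrow> bool" where
  "finitely_generated_semigroup G \<longleftrightarrow>
     (\<exists>X. X \<subseteq> carrier G \<and> finite X \<and> semigroup_span G X = carrier G)"

definition free_semigroup :: "'a set \<Rightarrow> 'a list monoid" where
  "free_semigroup A = \<lparr>carrier = {w \<in> lists A. w \<noteq> []}, mult = (@), one = undefined\<rparr>"

definition fiber_product ::
  "('a, 'm) monoid_scheme \<Rightarrow> ('b, 'n) monoid_scheme \<Rightarrow> ('a \<Rightarrow> 's) \<Rightarrow> ('b \<Rightarrow> 's) \<Rightarrow> ('a \<times> 'b) monoid" where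
  "fiber_product G H \<phi> \<psi> =
     (G \<times>\<times> H)\<lparr>carrier := {(u, v) \<in> carrier G \<times> carrier H. \<phi> u = \<psi> v}\<rparr>"

lemma is_semigroup_free_semigroup: "A \<noteq> {} \<Longrightarrow> is_semigroup (free_semigroup A)"
proof -
  assume "A \<noteq> {}"
  then obtain a where "a \<in> A" by blast
  then have "[a] \<in> carrier (free_semigroup A)"
    by (simp add: free_semigroup_def)
  then have "carrier (free_semigroup A) \<noteq> {}"
    by blast
  then show ?thesis
    unfolding is_semigroup_def by (simp add: free_semigroup_def)
qed

lemma is_semigroup_fiber_product:
  assumes "is_semigroup G" "is_semigroup H" "is_semigroup S" "\<phi> \<in> epi G S" "\<psi> \<in> epi H S"
  shows "is_semigroup (fiber_product G H \<phi> \<psi>)"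
proof -
  have img: "\<phi> ` carrier G = carrier S" "\<psi> ` carrier H = carrier S"
    using assms(4,5) by (auto simp: epi_def)
  obtain s where s: "s \<in> carrier S"
    using assms(3) by (auto simp: is_semigroup_def)
  obtain u where u: "u \<in> carrier G" "\<phi> u = s"
    using s img(1) by (metis imageE)
  obtain v where v: "v \<in> carrier H" "\<psi> v = s"
    using s img(2) by (metis imageE)
  have "(u, v) \<in> carrier (fiber_product G H \<phi> \<psi>)"
    using u v by (simp add: fiber_product_def)
  then have ne: "carrier (fiber_product G H \<phi> \<psi>) \<noteq> {}"
    by blast
  have "\<phi> \<in> hom G S" "\<psi> \<in> hom H S"
    using assms(4,5) by (auto simp: epi_def)
  then have "\<And>x y. x \<in> carrier G \<Longrightarrow> y \<in> carrier G \<Longrightarrow> \<phi> (x \<otimes>\<^bsub>G\<^esub> y) = \<phi> x \<otimes>\<^bsub>S\<^esub> \<phi> y"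
    and "\<And>x y. x \<in> carrier H \<Longrightarrow> y \<in> carrier H \<Longrightarrow> \<psi> (x \<otimes>\<^bsub>H\<^esub> y) = \<psi> x \<otimes>\<^bsub>S\<^esub> \<psi> y"
    by (auto simp: hom_mult)
  with ne assms(1,2) show ?thesis
    unfolding is_semigroup_def by (auto simp: fiber_product_def DirProd_def)
qed

end

theory Submission
  imports Defs
begin

text \<open>
  In a finitely generated subsemigroup of \<open>A\<^sup>+ \<times> B\<^sup>+\<close> the length of \<open>v\<close> is bounded by a fixed
  multiple of the length of \<open>u\<close>, over all its elements \<open>(u, v)\<close>: every generator has a non-empty
  first component, so the greatest length of a second component among the finitely many generators
  is a suitable factor, and such a linear bound survives products because lengths add
  (\<open>span_length_bound\<close>). The fiber product violates every bound of this kind. For a letter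
  \<open>b \<in> B\<close> the values \<open>\<psi> (b\<^sup>n)\<close> lie in the finite set \<open>S\<close>, so one of them, \<open>s\<close>, is
  attained for infinitely many \<open>n\<close>. As \<open>\<phi>\<close> is surjective, \<open>s = \<phi> u\<close> for some \<open>u\<close>, and the fiber
  product contains the pairs \<open>(u, b\<^sup>n)\<close> with this fixed \<open>u\<close> and unbounded \<open>n\<close>
  (\<open>fiber_product_unbounded\<close>).
\<close>

lemma carrier_fiber_product_free:
  "(u, v) \<in> carrier (fiber_product (free_semigroup A) (free_semigroup B) \<phi> \<psi>) \<longleftrightarrow>
    u \<in> lists A \<and> u \<noteq> [] \<and> v \<in> lists B \<and> v \<noteq> [] \<and> \<phi> u = \<psi> v"
  by (auto simp: fiber_product_def free_semigroup_def)

lemma mult_fiber_product_free: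
  "p \<otimes>\<^bsub>fiber_product (free_semigroup A) (free_semigroup B) \<phi> \<psi>\<^esub> q
    = (fst p @ fst q, snd p @ snd q)"
  by (cases p; cases q) (simp add: fiber_product_def free_semigroup_def)

text \<open>
  A single \<open>M\<close> serves all products because the bound has no additive constant: on a generator it
  is paid for by the non-empty first component, and it is then additive in both components.
\<close>

lemma span_length_bound:
  assumes "finite X"
    and "X \<subseteq> carrier (fiber_product (free_semigroup A) (free_semigroup B) \<phi> \<psi>)"
  obtains M where
    "\<And>p. p \<in> semigroup_span (fiber_product (free_semigroup A) (free_semigroup B) \<phi> \<psi>) X \<Longrightarrow>
       length (snd p) \<le> M * length (fst p)"
proof -
  obtain M where M: "\<And>p. p \<in> X \<Longrightarrow> length (snd p) \<le> M"
    using finite_imageI[OF \<open>finite X\<close>, of "length \<circ> snd"] by (auto simp: finite_nat_set_iff_bounded_le)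
  show ?thesis
  proof (rule that)
    fix p
    assume "p \<in> semigroup_span (fiber_product (free_semigroup A) (free_semigroup B) \<phi> \<psi>) X"
    then show "length (snd p) \<le> M * length (fst p)"
    proof (induction rule: semigroup_span.induct)
      case (incl p)
      then have "fst p \<noteq> []"
        using assms(2) carrier_fiber_product_free by (metis prod.collapse subsetD)
      then have "M \<le> M * length (fst p)"
        by (cases "fst p") auto
      from M[OF incl] this show ?case by (rule order_trans)
    next
      case (mult p q)
      then show ?case by (simp add: mult_fiber_product_free algebra_simps)
    qed
  qed
qed

text \<open>
  By the pigeonhole principle in the finite carrier of \<open>S\<close>, infinitely many powers of one letter
  of \<open>B\<close> share their image, and hence share a partner \<open>u\<close>.
\<close>

lemma fiber_product_unbounded:
  assumes "is_semigroup S" and "finite (carrier S)"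
    and "\<phi> \<in> epi (free_semigroup A) S" and "\<psi> \<in> epi (free_semigroup B) S"
  obtains u where
    "\<And>m. \<exists>v. (u, v) \<in> carrier (fiber_product (free_semigroup A) (free_semigroup B) \<phi> \<psi>)
            \<and> m < length v"
proof -
  have img: "\<phi> ` {w \<in> lists A. w \<noteq> []} = carrier S" "\<psi> ` {w \<in> lists B. w \<noteq> []} = carrier S"
    using assms(3,4) by (auto simp: epi_def free_semigroup_def)
  have "carrier S \<noteq> {}"
    using assms(1) by (simp add: is_semigroup_def)
  then obtain w where "w \<in> lists B" "w \<noteq> []"
    using img(2) by blast
  then obtain b where b: "b \<in> B"
    by (cases w) auto
  \<comment> \<open>Exponents are shifted by one, since the zeroth power is the empty word.\<close>
  define f where "f n = \<psi> (replicate (Suc n) b)" for n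
  have word: "replicate (Suc n) b \<in> {w \<in> lists B. w \<noteq> []}" for n
    using b by auto
  have fS: "f n \<in> carrier S" for n
    unfolding f_def img(2)[symmetric] using word by (rule imageI)
  then have "finite (range f)"
    using assms(2) by (auto intro: finite_subset)
  then obtain k where k: "infinite {n. f n = f k}"
    using pigeonhole_infinite[of "UNIV :: nat set" f] by auto
  have "f k \<in> \<phi> ` {w \<in> lists A. w \<noteq> []}"
    using fS img(1) by simp
  then obtain u where u: "u \<in> lists A" "u \<noteq> []" "\<phi> u = f k"
    by (metis (mono_tags, lifting) imageE mem_Collect_eq)
  have "\<exists>v. (u, v) \<in> carrier (fiber_product (free_semigroup A) (free_semigroup B) \<phi> \<psi>)
          \<and> m < length v" for m
  proof -
    obtain n where n: "m < n" "f n = f k"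
      using k unfolding finite_nat_set_iff_bounded_le by (auto simp: not_le)
    have "(u, replicate (Suc n) b)
        \<in> carrier (fiber_product (free_semigroup A) (free_semigroup B) \<phi> \<psi>)"
      unfolding carrier_fiber_product_free using u n(2) word[of n] by (simp add: f_def)
    moreover have "m < length (replicate (Suc n) b)"
      using n(1) by simp
    ultimately show ?thesis by blast
  qed
  then show ?thesis by (rule that)
qed

theorem proposition3p1:
  fixes A :: "'a set" and B :: "'b set" and S :: "('s, 'm) monoid_scheme"
    and \<phi> :: "'a list \<Rightarrow> 's" and \<psi> :: "'b list \<Rightarrow> 's"
  assumes "is_semigroup S" and "finite (carrier S)"
    and "\<phi> \<in> epi (free_semigroup A) S" and "\<psi> \<in> epi (free_semigroup B) S"
  shows "\<not> finitely_generated_semigroup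
           (fiber_product (free_semigroup A) (free_semigroup B) \<phi> \<psi>)"
proof
  let ?P = "fiber_product (free_semigroup A) (free_semigroup B) \<phi> \<psi>"
  assume "finitely_generated_semigroup ?P"
  then obtain X where X: "X \<subseteq> carrier ?P" "finite X" "semigroup_span ?P X = carrier ?P"
    unfolding finitely_generated_semigroup_def by blast
  obtain M where M: "\<And>p. p \<in> carrier ?P \<Longrightarrow> length (snd p) \<le> M * length (fst p)"
    using span_length_bound[OF X(2,1)] unfolding X(3) by blast
  obtain u where u: "\<And>m. \<exists>v. (u, v) \<in> carrier ?P \<and> m < length v"
    by (rule fiber_product_unbounded[OF assms]) blast
  from u[of "M * length u"] obtain v where "(u, v) \<in> carrier ?P" "M * length u < length v"
    by blast
  with M[of "(u, v)"] show False by simp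
qed

end
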